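(* Let $m>1$ be an integer, let $\ell$ be an odd integer, and let $H$, $A$, $B$, $C$, $s$, $\phi$ be as defined in the context. Let $i,j,k,a,b,c\in\mathbb{Z}$. Then in $H$ $$[A^iB^jC^k,A^aB^bC^c]=A^{e_A}B^{e_B}C^{e_C},$$ where $$e_A=2s\ell\{j\phi(a)-\phi(i)b+ic-ka\},$$ $$e_B=2s\ell\{i\phi(b)-\phi(j)a+kb+j(ib-ab-c)\},$$ $$e_C=ib-ja+2s\ell\{\phi(a)(\phi(j)+jb)-\phi(i)(\phi(b)+jb)+ijc-kab\}.$$
   Context: Notation: $[a,b]=a^{-1}b^{-1}ab$, $b^a=a^{-1}ba$ for group elements, $\alpha=1+2^m\ell$, $s=2^{m-1}$. Let $$J=\langle A,B\mid A^{[A,B]}=A^{\alpha},\ B^{[B,A]}=B^{\alpha},\ A^{2^{3m-1}}=B^{2^{3m-1}}=1\rangle$$ and $H=J/Z(J)$, which has the presentation $$H=\langle A,B\mid A^{[A,B]}=A^{\alpha},\ B^{[B,A]}=B^{\alpha},\ A^{2^{2m-1}}=B^{2^{2m-1}}=1\rangle,\qquad C=[A,B]\in H.$$ For $n\in\mathbb{Z}$, $\phi(n)=\frac{(n-1)n}{2}$. *)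

theory Defs
  imports "HOL-Algebra.Algebra"
begin

section \<open>Group presentations\<close>

text \<open>A word is a list of letters; \<open>(x, True)\<close> stands for the generator \<open>x\<close> and
  \<open>(x, False)\<close> for its formal inverse.\<close>

type_synonym 'g word = "('g \<times> bool) list"

inductive free_eq :: "'g word \<Rightarrow> 'g word \<Rightarrow> bool" where
  refl: "free_eq u u"
| sym: "free_eq u v \<Longrightarrow> free_eq v u"
| trans: "free_eq u v \<Longrightarrow> free_eq v w \<Longrightarrow> free_eq u w"
| cancel: "free_eq (u @ (x, e) # (x, \<not> e) # v) (u @ v)"

definition free_rel :: "('g word \<times> 'g word) set" where
  "free_rel = {(u, v). free_eq u v}"

text \<open>The free group on the elements of the type \<open>'g\<close>.\<close>

definition free_group :: "'g word set monoid" where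
  "free_group =
    \<lparr>carrier = UNIV // free_rel,
     monoid.mult = (\<lambda>U V. \<Union>u\<in>U. \<Union>v\<in>V. free_rel `` {u @ v}),
     monoid.one = free_rel `` {[]}\<rparr>"

definition free_gen :: "'g \<Rightarrow> 'g word set" where
  "free_gen x = free_rel `` {[(x, True)]}"

definition normal_closure :: "('a, 'b) monoid_scheme \<Rightarrow> 'a set \<Rightarrow> 'a set" where
  "normal_closure G R =
    generate G {g \<otimes>\<^bsub>G\<^esub> r \<otimes>\<^bsub>G\<^esub> inv\<^bsub>G\<^esub> g | g r. g \<in> carrier G \<and> r \<in> R}"

text \<open>The relators \<open>R\<close> are elements of the free group on \<open>'g\<close>.\<close>

definition presented_group :: "'g word set set \<Rightarrow> 'g word set set monoid" where
  "presented_group R = free_group Mod normal_closure free_group R"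

definition presented_gen :: "'g word set set \<Rightarrow> 'g \<Rightarrow> 'g word set set" where
  "presented_gen R x = normal_closure free_group R #>\<^bsub>free_group\<^esub> free_gen x"


section \<open>Commutators, conjugates, centre\<close>

definition commutator :: "('a, 'b) monoid_scheme \<Rightarrow> 'a \<Rightarrow> 'a \<Rightarrow> 'a" where
  "commutator G x y = inv\<^bsub>G\<^esub> x \<otimes>\<^bsub>G\<^esub> inv\<^bsub>G\<^esub> y \<otimes>\<^bsub>G\<^esub> x \<otimes>\<^bsub>G\<^esub> y"

text \<open>\<open>conjugate G y x\<close> is $y^x = x^{-1} y x$.\<close>

definition conjugate :: "('a, 'b) monoid_scheme \<Rightarrow> 'a \<Rightarrow> 'a \<Rightarrow> 'a" where
  "conjugate G y x = inv\<^bsub>G\<^esub> x \<otimes>\<^bsub>G\<^esub> y \<otimes>\<^bsub>G\<^esub> x"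

definition center :: "('a, 'b) monoid_scheme \<Rightarrow> 'a set" where
  "center G = {z \<in> carrier G. \<forall>g\<in>carrier G. z \<otimes>\<^bsub>G\<^esub> g = g \<otimes>\<^bsub>G\<^esub> z}"


section \<open>The groups \<open>J\<close> and \<open>H = J / Z(J)\<close>\<close>

datatype gen = GenA | GenB

definition alpha :: "nat \<Rightarrow> int \<Rightarrow> int" where
  "alpha m l = 1 + 2 ^ m * l"

text \<open>A relation $u = v$ is encoded as the relator $u v^{-1}$.\<close>

definition J_relators :: "nat \<Rightarrow> int \<Rightarrow> gen word set set" where
  "J_relators m l =
    (let F = free_group; A = free_gen GenA; B = free_gen GenB in
     {conjugate F A (commutator F A B) \<otimes>\<^bsub>F\<^esub> inv\<^bsub>F\<^esub> (A [^]\<^bsub>F\<^esub> alpha m l),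
      conjugate F B (commutator F B A) \<otimes>\<^bsub>F\<^esub> inv\<^bsub>F\<^esub> (B [^]\<^bsub>F\<^esub> alpha m l),
      A [^]\<^bsub>F\<^esub> ((2::nat) ^ (3 * m - 1)),
      B [^]\<^bsub>F\<^esub> ((2::nat) ^ (3 * m - 1))})"

definition J_group :: "nat \<Rightarrow> int \<Rightarrow> gen word set set monoid" where
  "J_group m l = presented_group (J_relators m l)"

definition H_group :: "nat \<Rightarrow> int \<Rightarrow> gen word set set set monoid" where
  "H_group m l = J_group m l Mod center (J_group m l)"

text \<open>The images in \<open>H\<close> of the generators of \<open>J\<close>.\<close>

definition H_gen :: "nat \<Rightarrow> int \<Rightarrow> gen \<Rightarrow> gen word set set set" where
  "H_gen m l x = center (J_group m l) #>\<^bsub>J_group m l\<^esub> presented_gen (J_relators m l) x"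

text \<open>The division is exact, since $(n-1)n$ is even.\<close>

definition phi :: "int \<Rightarrow> int" where
  "phi n = ((n - 1) * n) div 2"


section \<open>The constructions yield groups\<close>

lemma equiv_free_rel: "equiv UNIV free_rel"
proof (rule equivI)
  show "refl free_rel"
    by (simp add: refl_on_def free_rel_def free_eq.refl)
  show "sym free_rel"
    by (rule symI) (simp add: free_rel_def free_eq.sym)
  show "trans free_rel"
    unfolding free_rel_def by (rule transI) (use free_eq.trans in blast)
qed simp

lemma free_eq_append_left: "free_eq u v \<Longrightarrow> free_eq (w @ u) (w @ v)"
proof (induction rule: free_eq.induct)
  case (refl u)
  show ?case by (rule free_eq.refl)
next
  case (sym u v)
  from sym.IH show ?case by (rule free_eq.sym)
next
  case (trans u v x)
  from trans.IH show ?case by (rule free_eq.trans)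
next
  case (cancel u x e v)
  show ?case using free_eq.cancel[of "w @ u" x e v] by simp
qed

lemma free_eq_append_right: "free_eq u v \<Longrightarrow> free_eq (u @ w) (v @ w)"
proof (induction rule: free_eq.induct)
  case (refl u)
  show ?case by (rule free_eq.refl)
next
  case (sym u v)
  from sym.IH show ?case by (rule free_eq.sym)
next
  case (trans u v x)
  from trans.IH show ?case by (rule free_eq.trans)
next
  case (cancel u x e v)
  show ?case using free_eq.cancel[of u x e "v @ w"] by simp
qed

lemma free_eq_append: "free_eq u u' \<Longrightarrow> free_eq v v' \<Longrightarrow> free_eq (u @ v) (u' @ v')"
  by (meson free_eq.trans free_eq_append_left free_eq_append_right)

lemma free_group_mult:
  "(free_rel `` {u}) \<otimes>\<^bsub>free_group\<^esub> (free_rel `` {v}) = free_rel `` {u @ v}"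
proof -
  have "free_rel `` {u' @ v'} = free_rel `` {u @ v}"
    if "u' \<in> free_rel `` {u}" "v' \<in> free_rel `` {v}" for u' v'
  proof -
    have "(u @ v, u' @ v') \<in> free_rel"
      using that by (simp add: free_rel_def free_eq_append)
    then show ?thesis
      by (rule equiv_class_eq[OF equiv_free_rel, symmetric])
  qed
  then have "(\<Union>u'\<in>free_rel `` {u}. \<Union>v'\<in>free_rel `` {v}. free_rel `` {u' @ v'}) =
      (\<Union>u'\<in>free_rel `` {u}. \<Union>v'\<in>free_rel `` {v}. free_rel `` {u @ v})"
    by (simp only: cong: SUP_cong)
  also have "\<dots> = free_rel `` {u @ v}"
  proof -
    have "u \<in> free_rel `` {u}" "v \<in> free_rel `` {v}"
      by (simp_all add: free_rel_def free_eq.refl)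
    then show ?thesis by blast
  qed
  finally show ?thesis
    by (simp only: free_group_def monoid.simps)
qed

lemma free_eq_inverse:
  "free_eq (rev (map (\<lambda>(x, e). (x, \<not> e)) u) @ u) []"
proof (induction u)
  case (Cons a u)
  obtain x e where a: "a = (x, e)" by (cases a)
  have "free_eq (rev (map (\<lambda>(x, e). (x, \<not> e)) (a # u)) @ a # u)
      (rev (map (\<lambda>(x, e). (x, \<not> e)) u) @ u)"
    using free_eq.cancel[of "rev (map (\<lambda>(x, e). (x, \<not> e)) u)" x "\<not> e" u]
    by (simp add: a)
  then show ?case
    using Cons.IH by (rule free_eq.trans)
qed (simp add: free_eq.refl)

lemma group_free_group: "group (free_group :: 'g word set monoid)"
proof (rule groupI)
  fix U V W :: "'g word set"
  assume "U \<in> carrier free_group" "V \<in> carrier free_group" "W \<in> carrier free_group"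
  then obtain u v w where "U = free_rel `` {u}" "V = free_rel `` {v}" "W = free_rel `` {w}"
    by (auto simp: free_group_def elim!: quotientE)
  then show "U \<otimes>\<^bsub>free_group\<^esub> V \<otimes>\<^bsub>free_group\<^esub> W = U \<otimes>\<^bsub>free_group\<^esub> (V \<otimes>\<^bsub>free_group\<^esub> W)"
    by (simp add: free_group_mult)
next
  fix U V :: "'g word set"
  assume "U \<in> carrier free_group" "V \<in> carrier free_group"
  then obtain u v where "U = free_rel `` {u}" "V = free_rel `` {v}"
    by (auto simp: free_group_def elim!: quotientE)
  then have "U \<otimes>\<^bsub>free_group\<^esub> V = free_rel `` {u @ v}"
    by (simp add: free_group_mult)
  then show "U \<otimes>\<^bsub>free_group\<^esub> V \<in> carrier free_group"
    by (auto simp: free_group_def intro: quotientI)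
next
  show "\<one>\<^bsub>free_group\<^esub> \<in> carrier (free_group :: 'g word set monoid)"
    by (auto simp: free_group_def intro: quotientI)
next
  fix U :: "'g word set"
  assume "U \<in> carrier free_group"
  then obtain u where U: "U = free_rel `` {u}"
    by (auto simp: free_group_def elim!: quotientE)
  have one: "\<one>\<^bsub>free_group\<^esub> = free_rel `` {[] :: 'g word}"
    by (simp add: free_group_def)
  show "\<one>\<^bsub>free_group\<^esub> \<otimes>\<^bsub>free_group\<^esub> U = U"
    by (simp add: U one free_group_mult)
  define u' where "u' = rev (map (\<lambda>(x, e). (x, \<not> e)) u)"
  have "(u' @ u, []) \<in> free_rel"
    using free_eq_inverse[of u] by (simp add: free_rel_def u'_def)
  then have "free_rel `` {u'} \<otimes>\<^bsub>free_group\<^esub> U = \<one>\<^bsub>free_group\<^esub>"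
    by (simp add: U one free_group_mult equiv_class_eq[OF equiv_free_rel])
  moreover have "free_rel `` {u'} \<in> carrier free_group"
    by (auto simp: free_group_def intro: quotientI)
  ultimately show "\<exists>V\<in>carrier free_group. V \<otimes>\<^bsub>free_group\<^esub> U = \<one>\<^bsub>free_group\<^esub>"
    by blast
qed

lemma free_gen_carrier: "free_gen x \<in> carrier free_group"
  by (auto simp: free_group_def free_gen_def intro: quotientI)

lemma (in group) normal_closure_normal:
  assumes "R \<subseteq> carrier G"
  shows "normal_closure G R \<lhd> G"
  unfolding normal_closure_def
proof (rule normal_generateI)
  show "{g \<otimes> r \<otimes> inv g | g r. g \<in> carrier G \<and> r \<in> R} \<subseteq> carrier G"
    using assms by auto
next
  fix h g
  assume "h \<in> {g \<otimes> r \<otimes> inv g | g r. g \<in> carrier G \<and> r \<in> R}" and g: "g \<in> carrier G"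
  then obtain k r where k: "k \<in> carrier G" "r \<in> R" "h = k \<otimes> r \<otimes> inv k"
    by blast
  have "g \<otimes> h \<otimes> inv g = (g \<otimes> k) \<otimes> r \<otimes> inv (g \<otimes> k)"
    using k g assms by (simp add: subset_iff m_assoc inv_mult_group)
  then show "g \<otimes> h \<otimes> inv g \<in> {g \<otimes> r \<otimes> inv g | g r. g \<in> carrier G \<and> r \<in> R}"
    using k g by blast
qed

lemma center_carrier: "z \<in> center G \<Longrightarrow> z \<in> carrier G"
  by (simp add: center_def)

lemma center_commute:
  "z \<in> center G \<Longrightarrow> g \<in> carrier G \<Longrightarrow> z \<otimes>\<^bsub>G\<^esub> g = g \<otimes>\<^bsub>G\<^esub> z"
  by (simp add: center_def)

lemma centerI:
  assumes "z \<in> carrier G" "\<And>g. g \<in> carrier G \<Longrightarrow> z \<otimes>\<^bsub>G\<^esub> g = g \<otimes>\<^bsub>G\<^esub> z"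
  shows "z \<in> center G"
  unfolding center_def using assms by blast

lemma (in group) center_normal: "center G \<lhd> G"
proof (rule normal_invI)
  show "subgroup (center G) G"
  proof (rule subgroupI)
    show "center G \<subseteq> carrier G"
      by (rule subsetI) (rule center_carrier)
    have "\<one> \<in> center G"
      by (rule centerI) simp_all
    then show "center G \<noteq> {}"
      by blast
  next
    fix a assume a: "a \<in> center G"
    note a' = center_carrier[OF a]
    show "inv a \<in> center G"
    proof (rule centerI)
      fix g assume g: "g \<in> carrier G"
      have "inv (a \<otimes> inv g) = inv (inv g \<otimes> a)"
        using center_commute[OF a inv_closed[OF g]] by (rule arg_cong)
      then show "inv a \<otimes> g = g \<otimes> inv a"
        using a' g by (simp add: inv_mult_group)
    qed (simp add: a')
  next
    fix a b assume a: "a \<in> center G" and b: "b \<in> center G"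
    note a' = center_carrier[OF a] and b' = center_carrier[OF b]
    show "a \<otimes> b \<in> center G"
    proof (rule centerI)
      fix g assume g: "g \<in> carrier G"
      have "a \<otimes> b \<otimes> g = a \<otimes> (b \<otimes> g)"
        by (rule m_assoc[OF a' b' g])
      also have "\<dots> = a \<otimes> (g \<otimes> b)"
        by (simp only: center_commute[OF b g])
      also have "\<dots> = a \<otimes> g \<otimes> b"
        by (rule m_assoc[OF a' g b', symmetric])
      also have "\<dots> = g \<otimes> a \<otimes> b"
        by (simp only: center_commute[OF a g])
      also have "\<dots> = g \<otimes> (a \<otimes> b)"
        by (rule m_assoc[OF g a' b'])
      finally show "a \<otimes> b \<otimes> g = g \<otimes> (a \<otimes> b)" .
    qed (simp add: a' b')
  qed
next
  fix x h assume x: "x \<in> carrier G" and h: "h \<in> center G"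
  note h' = center_carrier[OF h]
  have "x \<otimes> h \<otimes> inv x = h \<otimes> x \<otimes> inv x"
    by (simp only: center_commute[OF h x])
  also have "\<dots> = h"
    using x h' by (simp add: m_assoc)
  finally show "x \<otimes> h \<otimes> inv x \<in> center G"
    using h by simp
qed

lemma J_relators_carrier: "J_relators m l \<subseteq> carrier free_group"
proof -
  interpret F: group "free_group :: gen word set monoid"
    by (rule group_free_group)
  show ?thesis
    by (auto simp: J_relators_def Let_def conjugate_def commutator_def free_gen_carrier)
qed

lemma group_J_group: "group (J_group m l)"
  unfolding J_group_def presented_group_def
  by (intro normal.factorgroup_is_group group.normal_closure_normal
      group_free_group J_relators_carrier)

lemma group_H_group: "group (H_group m l)"
  unfolding H_group_def
  by (intro normal.factorgroup_is_group group.center_normal group_J_group)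

lemma presented_gen_carrier:
  "presented_gen (J_relators m l) x \<in> carrier (J_group m l)"
  by (auto simp: J_group_def presented_group_def presented_gen_def FactGroup_def RCOSETS_def
      intro: free_gen_carrier)

lemma H_gen_carrier: "H_gen m l x \<in> carrier (H_group m l)"
  by (auto simp: H_group_def H_gen_def FactGroup_def RCOSETS_def
      intro: presented_gen_carrier)

end

theory Submission
  imports Defs
begin

text \<open>
  Write \<open>C = [A,B]\<close> and \<open>\<alpha> = 1 + w\<close> with \<open>w = 2^m \<ell> = 2 s \<ell>\<close>.  The relations say that \<open>C\<close> acts on
  \<open>\<langle>A\<rangle>\<close> as \<open>x \<mapsto> x^\<alpha>\<close> and \<open>C^(-1)\<close> acts on \<open>\<langle>B\<rangle>\<close> in the same way.  The argument has two halves.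

  \<^emph>\<open>The orders in \<open>H\<close>.\<close>  In \<open>J\<close> the generators satisfy \<open>A^(2^(3m-1)) = B^(2^(3m-1)) = 1\<close>; in
  \<open>H = J/Z(J)\<close> the exponent drops to \<open>N = 2^(2m-1)\<close>, that is, \<open>A^N\<close> and \<open>B^N\<close> are central in \<open>J\<close>.
  This rests on Macdonald's computation of \<open>A\<close> conjugated by \<open>B^\<alpha>\<close> in two ways
  (\<open>macdonald_relation\<close>), which produces a relation \<open>A^T = B^(- \<alpha>^(\<alpha>+1) T)\<close> with
  \<open>T = 1 + \<alpha> + \<dots> + \<alpha>^(\<alpha>-1) - \<alpha>^\<alpha>\<close>.  The exact power of two in \<open>T\<close> is \<open>N\<close>
  (\<open>macdonald_exponent_two_part\<close>), and the orders of \<open>A\<close> and \<open>B\<close> are powers of two, so \<open>A^N\<close> is a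
  power of \<open>B\<close> and \<open>B^N\<close> is a power of \<open>A\<close>.  Each therefore commutes with both generators.  (Where \<open>\<alpha>\<close>
  counts summands or factors, it is replaced by its residue modulo \<open>2^(3m-1)\<close>.)

  \<^emph>\<open>Collection in \<open>H\<close>.\<close>  Modulo \<open>N\<close> all the exponents become polynomial: \<open>N\<close> divides \<open>w\<^sup>2/2\<close>, so
  \<open>\<alpha>^k\<close> may be replaced by \<open>1 + k w\<close>, and \<open>C^N = 1\<close> follows.  Moving powers of \<open>A\<close> to the left past
  powers of \<open>B\<close> (\<open>BApow\<close>) and of \<open>C\<close> gives a multiplication formula for the products
  \<open>A^i B^j C^k\<close> (\<open>collected_mult\<close>).  A commutator \<open>z = [x,y]\<close> is determined by \<open>x y = y x z\<close>, so the claimed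
  formula reduces to comparing two triples of exponents modulo \<open>N\<close> (\<open>commutator_collected\<close>).
\<close>

section \<open>Powers and commutators in groups\<close>

context group
begin

text \<open>Most power formulas below are proved through this uniqueness principle: a closed form, valid for
  negative exponents as well, only needs the right one-step behaviour.\<close>

lemma int_pow_recurrence:
  fixes f :: "int \<Rightarrow> 'a"
  assumes x: "x \<in> carrier G" and f: "\<And>n. f n \<in> carrier G"
    and step: "\<And>n. f (n + 1) = f n \<otimes> x"
  shows "f n = f 0 \<otimes> x [^] n"
proof (induction n rule: int_induct[where k = 0])
  case base
  show ?case using f by simp
next
  case (step1 n)
  then show ?case
    using x f by (simp add: step int_pow_mult m_assoc)
next
  case (step2 n)
  have "f (n - 1) \<otimes> x = f 0 \<otimes> x [^] (n - 1) \<otimes> x"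
    using step[of "n - 1"] step2.IH int_pow_mult[OF x, of "n - 1" 1] x f by (simp add: m_assoc)
  then show ?case
    using x f by simp
qed

text \<open>The relation \<open>x^g = y\<close> in a form free of inverses, which suits rewriting of products.\<close>

lemma int_pow_intertwine:
  assumes "x \<in> carrier G" "y \<in> carrier G" "g \<in> carrier G" and eq: "x \<otimes> g = g \<otimes> y"
  shows "x [^] (n::int) \<otimes> g = g \<otimes> y [^] n"
proof -
  have "x [^] n \<otimes> g = x [^] (0::int) \<otimes> g \<otimes> y [^] n"
  proof (rule int_pow_recurrence[where f = "\<lambda>n. x [^] n \<otimes> g"])
    fix n :: int
    show "x [^] (n + 1) \<otimes> g = x [^] n \<otimes> g \<otimes> y"
      using assms by (simp add: int_pow_mult m_assoc)
  qed (use assms in simp_all)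
  then show ?thesis using assms by simp
qed

lemma int_pow_cong:
  assumes x: "x \<in> carrier G" "x [^] (N::int) = \<one>" and "N dvd a - b"
  shows "x [^] a = x [^] b"
proof -
  obtain t where "a = N * t + b"
    using assms(3) by (metis dvd_def diff_eq_eq)
  then show ?thesis
    using x by (simp add: int_pow_mult flip: int_pow_pow)
qed

lemma commutator_eqI:
  assumes "x \<in> carrier G" "y \<in> carrier G" "z \<in> carrier G" "x \<otimes> y = y \<otimes> x \<otimes> z"
  shows "commutator G x y = z"
proof -
  have "x \<otimes> y = y \<otimes> (x \<otimes> z)" using assms by (simp add: m_assoc)
  then show ?thesis
    unfolding commutator_def using assms by (simp add: m_assoc inv_solve_left')
qed

lemma mult_inv_cancel:
  assumes "x \<in> carrier G" "z \<in> carrier G"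
  shows "x \<otimes> (inv x \<otimes> z) = z"
  using assms by (simp flip: m_assoc)

lemma commutator_swap:
  assumes "x \<in> carrier G" "y \<in> carrier G"
  shows "x \<otimes> y = y \<otimes> x \<otimes> commutator G x y"
  unfolding commutator_def using assms by (simp add: m_assoc mult_inv_cancel)

lemma inv_commutator:
  assumes "x \<in> carrier G" "y \<in> carrier G"
  shows "inv (commutator G x y) = commutator G y x"
  unfolding commutator_def using assms by (simp add: m_assoc inv_mult_group)

lemma conjugate_eq_iff:
  assumes "x \<in> carrier G" "y \<in> carrier G" "g \<in> carrier G"
  shows "conjugate G x g = y \<longleftrightarrow> x \<otimes> g = g \<otimes> y"
  unfolding conjugate_def using assms by (metis inv_solve_left m_assoc m_closed inv_closed)

end

section \<open>The Macdonald relations\<close>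

text \<open>The relations \<open>C = [A,B]\<close>, \<open>A^C = A^q\<close> and \<open>B^(C^(-1)) = B^q\<close>, written without inverses so that
  they act as collection rules.  The exponent \<open>q\<close> is left open because it is used both as a
  positive representative of \<open>\<alpha>\<close> modulo the order of the generators and as \<open>\<alpha>\<close> itself.\<close>

locale macdonald = group +
  fixes A B C :: 'a and q :: int
  assumes A: "A \<in> carrier G" and B: "B \<in> carrier G" and C: "C \<in> carrier G"
    and AB: "A \<otimes> B = B \<otimes> A \<otimes> C"
    and AC: "A \<otimes> C = C \<otimes> A [^] q"
    and CB: "C \<otimes> B = B [^] q \<otimes> C"
begin

lemmas ABC = A B C

lemma BA: "B \<otimes> A = A \<otimes> (B \<otimes> inv C)"
proof -
  have "B \<otimes> A \<otimes> C = A \<otimes> (B \<otimes> inv C) \<otimes> C"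
    using ABC by (simp add: AB[symmetric] m_assoc)
  then show ?thesis using ABC by simp
qed

lemma BC': "B \<otimes> inv C = inv C \<otimes> B [^] q"
proof -
  have "C \<otimes> (B \<otimes> inv C) = B [^] q"
    using ABC CB by (metis inv_solve_right' int_pow_closed inv_closed m_assoc m_closed)
  then show ?thesis using ABC by (metis inv_solve_left int_pow_closed inv_closed m_closed)
qed

lemma Apow_B: "A [^] (n::int) \<otimes> B = B \<otimes> (A \<otimes> C) [^] n"
  by (rule int_pow_intertwine) (use ABC AB in \<open>simp_all add: m_assoc\<close>)

lemma Bpow_A: "B [^] (n::int) \<otimes> A = A \<otimes> (B \<otimes> inv C) [^] n"
  by (rule int_pow_intertwine) (use ABC BA in simp_all)

end

context macdonald
begin

lemma Apow_Cpow:
  "A [^] (x::int) \<otimes> C [^] int k = C [^] int k \<otimes> A [^] (x * q ^ k)"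
proof (induction k arbitrary: x)
  case 0
  show ?case using ABC by simp
next
  case (Suc k)
  have step: "A [^] (y::int) \<otimes> C = C \<otimes> A [^] (q * y)" for y
    using int_pow_intertwine[OF _ _ _ AC, of y] ABC by (simp add: int_pow_pow)
  have "A [^] x \<otimes> C [^] int (Suc k) = A [^] x \<otimes> C [^] int k \<otimes> C"
    using ABC int_pow_mult[of C "int k" 1] by (simp add: m_assoc add.commute)
  also have "\<dots> = C [^] int k \<otimes> (A [^] (x * q ^ k) \<otimes> C)"
    using ABC by (simp add: Suc.IH m_assoc)
  also have "\<dots> = C [^] int k \<otimes> C \<otimes> A [^] (x * q ^ Suc k)"
    using ABC by (simp add: step m_assoc mult.left_commute)
  finally show ?case
    using ABC int_pow_mult[of C "int k" 1] by (simp add: add.commute)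
qed

lemma Cpow_Bpow:
  "C [^] int k \<otimes> B [^] (x::int) = B [^] (x * q ^ k) \<otimes> C [^] int k"
proof (induction k arbitrary: x)
  case 0
  show ?case using ABC by simp
next
  case (Suc k)
  have step: "C \<otimes> B [^] (y::int) = B [^] (q * y) \<otimes> C" for y
    using int_pow_intertwine[OF _ _ _ CB[symmetric], of y] ABC by (simp add: int_pow_pow)
  have "C [^] int (Suc k) \<otimes> B [^] x = C [^] int k \<otimes> (C \<otimes> B [^] x)"
    using ABC int_pow_mult[of C "int k" 1] by (simp add: m_assoc add.commute)
  also have "\<dots> = C [^] int k \<otimes> B [^] (q * x) \<otimes> C"
    using ABC by (simp add: step m_assoc)
  also have "\<dots> = B [^] (x * q ^ Suc k) \<otimes> (C [^] int k \<otimes> C)"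
    using ABC by (simp add: Suc.IH m_assoc mult_ac)
  finally show ?case
    using ABC int_pow_mult[of C "int k" 1] by (simp add: add.commute)
qed

lemma CA_pow: "(C \<otimes> A) [^] int k = C [^] int k \<otimes> A [^] (\<Sum>t<k. q ^ t)"
proof (induction k)
  case (Suc k)
  let ?S = "\<Sum>t<k. q ^ t"
  have "(C \<otimes> A) [^] int (Suc k) = (C \<otimes> A) \<otimes> (C [^] int k \<otimes> A [^] ?S)"
    using ABC int_pow_mult[of "C \<otimes> A" 1 "int k"] by (simp add: Suc.IH)
  also have "\<dots> = C \<otimes> (A [^] (1::int) \<otimes> C [^] int k) \<otimes> A [^] ?S"
    using ABC by (simp add: m_assoc)
  also have "\<dots> = C \<otimes> C [^] int k \<otimes> (A [^] (q ^ k) \<otimes> A [^] ?S)"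
    unfolding Apow_Cpow using ABC by (simp add: m_assoc)
  also have "\<dots> = C [^] int (Suc k) \<otimes> A [^] (\<Sum>t<Suc k. q ^ t)"
    using ABC int_pow_mult[of C 1 "int k"] by (simp add: add.commute flip: int_pow_mult)
  finally show ?case .
qed (use ABC in simp)

lemma B_invC_pow: "(B \<otimes> inv C) [^] int k = inv (C [^] int k) \<otimes> B [^] (q * (\<Sum>t<k. q ^ t))"
proof (induction k)
  case (Suc k)
  let ?S = "\<Sum>t<k. q ^ t"
  have S: "(\<Sum>t<Suc k. q ^ t) = q * ?S + 1"
    unfolding sum.lessThan_Suc_shift by (simp add: sum_distrib_left)
  have step: "B [^] (y::int) \<otimes> inv C = inv C \<otimes> B [^] (q * y)" for y
    using int_pow_intertwine[OF _ _ _ BC', of y] ABC by (simp add: int_pow_pow)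
  have Bs: "B [^] (q * ?S) \<otimes> B = B [^] (q * ?S + 1)"
    using ABC by (simp add: int_pow_mult)
  have Cs: "C [^] int (Suc k) = C \<otimes> C [^] int k"
    using ABC int_pow_mult[of C 1 "int k"] by simp
  have "(B \<otimes> inv C) [^] int (Suc k) = (inv (C [^] int k) \<otimes> B [^] (q * ?S)) \<otimes> (B \<otimes> inv C)"
    using ABC int_pow_mult[of "B \<otimes> inv C" "int k" 1] by (simp add: Suc.IH add.commute)
  also have "\<dots> = inv (C [^] int k) \<otimes> (B [^] (q * ?S) \<otimes> B \<otimes> inv C)"
    using ABC by (simp add: m_assoc)
  also have "\<dots> = inv (C [^] int k) \<otimes> inv C \<otimes> B [^] (q * (\<Sum>t<Suc k. q ^ t))"
    unfolding Bs step S using ABC by (simp add: m_assoc)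
  also have "\<dots> = inv (C [^] int (Suc k)) \<otimes> B [^] (q * (\<Sum>t<Suc k. q ^ t))"
    using ABC by (simp add: Cs inv_mult_group del: of_nat_Suc)
  finally show ?case .
qed (use ABC in simp)

text \<open>Moving \<open>C\<close> past \<open>B\<close> multiplies the exponent of \<open>B\<close> by \<open>q\<close>, so \<open>B^q\<close> arises as \<open>C B C^(-1)\<close>.  This
  gives a second way to conjugate \<open>A\<close> by \<open>B^q\<close>: through \<open>A^B = A C\<close> instead of through
  \<open>B^A = B C^(-1)\<close>.\<close>

lemma A_Bpow_q: "A \<otimes> B [^] q = B [^] q \<otimes> (C \<otimes> A) [^] q"
proof -
  have CAC: "(C \<otimes> A) [^] q \<otimes> C = C \<otimes> (A \<otimes> C) [^] q"
    by (rule int_pow_intertwine) (use ABC in \<open>simp_all add: m_assoc\<close>)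
  have "A \<otimes> B [^] q \<otimes> C = A \<otimes> C \<otimes> B"
    using ABC by (simp add: m_assoc CB)
  also have "\<dots> = C \<otimes> (A [^] q \<otimes> B)"
    using ABC by (simp add: m_assoc AC)
  also have "\<dots> = (C \<otimes> B) \<otimes> (A \<otimes> C) [^] q"
    using ABC by (simp add: m_assoc Apow_B)
  also have "\<dots> = B [^] q \<otimes> (C \<otimes> A) [^] q \<otimes> C"
    using ABC by (simp add: m_assoc CB CAC)
  finally show ?thesis
    using ABC by (metis right_cancel int_pow_closed m_closed)
qed

text \<open>Macdonald's relation.  With \<open>K = C^q\<close> and \<open>S = 1 + q + \<dots> + q^(q-1)\<close>, the lemma \<open>A_Bpow_q\<close> gives
  \<open>A B^q = B^q K A^S\<close>, whereas \<open>B^A = B C^(-1)\<close> gives \<open>B^q A = A K^(-1) B^(q S)\<close>.  Eliminating the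
  mixed terms leaves \<open>K A^T K^(-1) = B^(- q T)\<close>; raising this to the power \<open>q^q\<close>
  undoes the conjugation by \<open>K\<close>.\<close>

lemma macdonald_relation:
  assumes q: "q = int n"
  defines "T \<equiv> (\<Sum>t<n. q ^ t) - q ^ n"
  shows "A [^] T = B [^] (- (q ^ (n + 1) * T))"
proof -
  let ?S = "\<Sum>t<n. q ^ t"
  let ?y = "q * q ^ n - q * ?S"
  define K where "K = C [^] q"
  have K: "K \<in> carrier G" and Kn: "C [^] int n = K"
    using ABC by (simp_all add: K_def q)
  have BK: "B [^] q \<otimes> A = A \<otimes> (inv K \<otimes> B [^] (q * ?S))"
    using Bpow_A[of q] B_invC_pow[of n] by (simp add: K_def flip: q)
  have AK: "A \<otimes> B [^] q = B [^] q \<otimes> (K \<otimes> A [^] ?S)"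
    using A_Bpow_q CA_pow[of n] by (simp add: K_def flip: q)
  \<comment> \<open>\<open>BK\<close> solved for \<open>A\<close>; substituting this for \<open>A\<close> in \<open>A B^q\<close> makes \<open>B^q\<close> cancel against \<open>AK\<close>\<close>
  have swap: "B [^] q \<otimes> (A \<otimes> (B [^] (- (q * ?S)) \<otimes> K)) = A"
  proof -
    have "B [^] q \<otimes> (A \<otimes> (B [^] (- (q * ?S)) \<otimes> K))
        = (B [^] q \<otimes> A) \<otimes> (B [^] (- (q * ?S)) \<otimes> K)"
      using ABC K by (simp add: m_assoc)
    also have "\<dots> = A \<otimes> (inv K \<otimes> ((B [^] (q * ?S) \<otimes> B [^] (- (q * ?S))) \<otimes> K))"
      unfolding BK using ABC K by (simp add: m_assoc)
    also have "\<dots> = A"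
      using ABC K by (simp flip: int_pow_mult)
    finally show ?thesis .
  qed
  have KB: "K \<otimes> B [^] x = B [^] (x * q ^ n) \<otimes> K" for x
    using Cpow_Bpow[of n x] by (simp only: Kn)
  have AKp: "A [^] x \<otimes> K = K \<otimes> A [^] (x * q ^ n)" for x
    using Apow_Cpow[of x n] by (simp only: Kn)
  have "B [^] q \<otimes> (K \<otimes> A [^] ?S) = A \<otimes> B [^] q"
    by (simp add: AK)
  also have "\<dots> = B [^] q \<otimes> (A \<otimes> (B [^] (- (q * ?S)) \<otimes> K)) \<otimes> B [^] q"
    by (simp add: swap)
  also have "\<dots> = B [^] q \<otimes> (A \<otimes> (B [^] (- (q * ?S)) \<otimes> (K \<otimes> B [^] q)))"
    using ABC K by (simp add: m_assoc)
  also have "\<dots> = B [^] q \<otimes> (A \<otimes> ((B [^] (- (q * ?S)) \<otimes> B [^] (q * q ^ n)) \<otimes> K))"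
    unfolding KB using ABC K by (simp add: m_assoc)
  also have "\<dots> = B [^] q \<otimes> (A \<otimes> (B [^] ?y \<otimes> K))"
    using ABC by (simp flip: int_pow_mult)
  finally have "K \<otimes> A [^] ?S = A \<otimes> (B [^] ?y \<otimes> K)"
    using ABC K by simp
  moreover have "K \<otimes> A [^] ?S = A \<otimes> (K \<otimes> A [^] T)"
  proof -
    have "A \<otimes> (K \<otimes> A [^] T) = (A [^] (1::int) \<otimes> K) \<otimes> A [^] T"
      using ABC K by (simp add: m_assoc)
    also have "\<dots> = K \<otimes> (A [^] (q ^ n) \<otimes> A [^] T)"
      unfolding AKp using ABC K by (simp add: m_assoc)
    also have "\<dots> = K \<otimes> A [^] ?S"
      using ABC K by (simp add: T_def flip: int_pow_mult)
    finally show ?thesis ..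
  qed
  ultimately have eq: "B [^] ?y \<otimes> K = K \<otimes> A [^] T"
    using ABC K by simp
  have "B [^] (?y * q ^ n) \<otimes> K = K \<otimes> A [^] (T * q ^ n)"
    using int_pow_intertwine[OF _ _ _ eq, of "q ^ n"] ABC K by (simp add: int_pow_pow)
  also have "\<dots> = A [^] T \<otimes> K"
    by (rule AKp[symmetric])
  finally have "A [^] T = B [^] (?y * q ^ n)"
    using ABC K by simp
  also have "?y * q ^ n = - (q ^ (n + 1) * T)"
    by (simp add: T_def algebra_simps)
  finally show ?thesis .
qed

end

section \<open>The power of two in the exponent\<close>

lemma two_phi: "2 * phi n = (n - 1) * n"
  by (simp add: phi_def)

lemma phi_add: "phi (x + y) = phi x + phi y + x * y"
proof -
  have "2 * phi (x + y) = 2 * (phi x + phi y + x * y)"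
    unfolding distrib_left two_phi by (simp add: algebra_simps)
  then show ?thesis by simp
qed

lemma phi_0 [simp]: "phi 0 = 0" and phi_1 [simp]: "phi 1 = 0"
  by (simp_all add: phi_def)

lemma dvd_diffE:
  fixes a b d :: int
  assumes "d dvd a - b"
  obtains c where "a = b + d * c"
  using assms by (metis dvd_def diff_eq_eq add.commute)

lemma power_mod_square:
  fixes u :: int
  shows "u * u dvd (1 + u) ^ k - (1 + int k * u)"
proof (induction k)
  case (Suc k)
  from Suc.IH obtain c where "(1 + u) ^ k = 1 + int k * u + u * u * c"
    by (rule dvd_diffE)
  then have "(1 + u) ^ Suc k - (1 + int (Suc k) * u) = u * u * (int k + c * (1 + u))"
    by (simp add: algebra_simps)
  then show ?case by simp
qed simp

lemma geometric_sum_mod_square: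
  fixes u :: int
  shows "u * u dvd (\<Sum>t<k. (1 + u) ^ t) - (int k + u * phi (int k))"
proof (induction k)
  case (Suc k)
  have "phi (int (Suc k)) = phi (int k) + int k"
    using phi_add[of "int k" 1] by (simp add: add.commute)
  then have "(\<Sum>t<Suc k. (1 + u) ^ t) - (int (Suc k) + u * phi (int (Suc k)))
    = ((\<Sum>t<k. (1 + u) ^ t) - (int k + u * phi (int k))) + ((1 + u) ^ k - (1 + int k * u))"
    by (simp add: algebra_simps)
  then show ?case
    using Suc.IH power_mod_square[of u k] by (metis dvd_add)
qed simp

text \<open>Let \<open>u = 2^m r\<close>, let \<open>S\<close> be the sum of powers and \<open>T = S - q^q\<close>.  Then
  \<open>S \<equiv> q + u \<phi>(q) = q + u\<^sup>2 q / 2\<close> and \<open>q^q \<equiv> 1 + q u\<close> modulo \<open>u\<^sup>2\<close>, hence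
  \<open>T \<equiv> u\<^sup>2/2\<close> modulo \<open>u\<^sup>2\<close> as \<open>u\<close> is even.  So \<open>T\<close> has exactly one factor 2 less than
  \<open>u\<^sup>2\<close>, which has \<open>2 m\<close> of them.\<close>

lemma macdonald_exponent_two_part:
  fixes q r :: int
  assumes q: "q = int n" "q = 1 + 2 ^ m * r" and "odd r" "m > 0"
  obtains t where "(\<Sum>t<n. q ^ t) - q ^ n = 2 ^ (2 * m - 1) * t" "odd t"
proof -
  define u where "u = 2 ^ m * r"
  have qu: "q = 1 + u" by (simp add: q(2) u_def)
  have n: "int n = 1 + u" using q(1) qu by simp
  obtain c where c: "(\<Sum>t<n. q ^ t) = (1 + u) + u * phi (1 + u) + u * u * c"
    using geometric_sum_mod_square[of u n] unfolding n qu
    by (rule dvd_diffE)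
  obtain d where d: "q ^ n = 1 + (1 + u) * u + u * u * d"
    using power_mod_square[of u n] unfolding n qu
    by (rule dvd_diffE)
  let ?T = "(\<Sum>t<n. q ^ t) - q ^ n"
  let ?t = "r * r * (1 + u - 2 + 2 * (c - d))"
  have "2 * ?T = u * (2 * phi (1 + u)) + 2 * (u * u * (c - d - 1))"
    unfolding c d by (simp add: algebra_simps)
  also have "\<dots> = (u * u) * (1 + u - 2 + 2 * (c - d))"
    unfolding two_phi by (simp add: algebra_simps)
  also have "u * u = 2 * 2 ^ (2 * m - 1) * (r * r)"
  proof -
    have "Suc (2 * m - 1) = m + m" using \<open>m > 0\<close> by simp
    then have "(2::int) * 2 ^ (2 * m - 1) = 2 ^ m * 2 ^ m"
      by (simp flip: power_Suc power_add)
    then show ?thesis by (simp add: u_def)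
  qed
  finally have "?T = 2 ^ (2 * m - 1) * ?t"
    by (simp add: mult.assoc)
  moreover have "even u" using \<open>m > 0\<close> by (simp add: u_def)
  then have "odd ?t" using \<open>odd r\<close> by simp
  ultimately show ?thesis by (rule that)
qed

text \<open>In an element of 2-power order, odd factors of an exponent can be undone.\<close>

lemma (in group) int_pow_odd_part:
  assumes x: "x \<in> carrier G" "x [^] ((2::int) ^ e) = \<one>" and "odd t"
  obtains v where "x [^] (N::int) = (x [^] (N * t)) [^] (v::int)"
proof -
  have "coprime t (2 ^ e)" using \<open>odd t\<close> by simp
  then obtain v y where vy: "v * t + y * 2 ^ e = 1"
    using bezout_int[of t "2 ^ e"] by (auto simp: coprime_iff_gcd_eq_1)
  have "N - N * t * v = 2 ^ e * (N * y)"
    using arg_cong[OF vy, of "\<lambda>z. N * z"] by (simp add: algebra_simps)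
  then have "x [^] N = x [^] (N * t * v)"
    using x by (intro int_pow_cong[OF x]) simp
  then show ?thesis
    using x by (intro that[of v]) (simp add: int_pow_pow)
qed

text \<open>Macdonald's relation equates a power of \<open>A\<close> with a power of \<open>B\<close>, both with exponent \<open>N\<close> times an odd
  number.  So \<open>A^N\<close> is a power of \<open>B\<close> and conversely.\<close>

lemma (in macdonald) power_commutes:
  assumes q: "q = int n" "q = 1 + 2 ^ m * r" and "odd r" "m > 0"
    and ord: "A [^] ((2::int) ^ e) = \<one>" "B [^] ((2::int) ^ e) = \<one>"
  defines "N \<equiv> (2::int) ^ (2 * m - 1)"
  shows "A [^] N \<otimes> B = B \<otimes> A [^] N" and "B [^] N \<otimes> A = A \<otimes> B [^] N"
proof -
  obtain t where t: "(\<Sum>t<n. q ^ t) - q ^ n = N * t" "odd t"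
    using macdonald_exponent_two_part[OF q \<open>odd r\<close> \<open>m > 0\<close>] unfolding N_def by blast
  have rel: "A [^] (N * t) = B [^] (N * (- (q ^ (n + 1) * t)))"
    using macdonald_relation[OF q(1)] by (simp add: t(1) mult_ac)
  have self: "x [^] (z::int) \<otimes> x = x \<otimes> x [^] z" if "x \<in> carrier G" for x z
    by (rule int_pow_intertwine) (use that in simp_all)
  obtain v where "A [^] N = (A [^] (N * t)) [^] (v::int)"
    using int_pow_odd_part[OF A ord(1) t(2)] by blast
  then show "A [^] N \<otimes> B = B \<otimes> A [^] N"
    using B by (simp add: rel int_pow_pow self)
  have "odd (- (q ^ (n + 1) * t))"
    using t(2) q(2) \<open>m > 0\<close> by simp
  then obtain v where "B [^] N = (A [^] (N * t)) [^] (v::int)"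
    using int_pow_odd_part[OF B ord(2)] unfolding rel by blast
  then show "B [^] N \<otimes> A = A \<otimes> B [^] N"
    using A by (simp add: int_pow_pow self)
qed

section \<open>Collection of products\<close>

text \<open>If \<open>v\<^sup>2\<close> kills \<open>x\<close>, the \<open>k\<close>-th iterate of \<open>x \<mapsto> x^(1+v)\<close> is \<open>x \<mapsto> x^(1+kv)\<close>, also for
  negative \<open>k\<close>.\<close>

lemma (in group) int_pow_affine_conj:
  assumes x: "x \<in> carrier G" "x [^] (N::int) = \<one>" and g: "g \<in> carrier G"
    and eq: "x \<otimes> g = g \<otimes> x [^] (1 + v)" and N: "N dvd v * v"
  shows "x [^] (n::int) \<otimes> g [^] (k::int) = g [^] k \<otimes> x [^] (n * (1 + k * v))"
proof -
  have step: "x [^] y \<otimes> g = g \<otimes> x [^] ((1 + v) * y)" for y :: int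
    using int_pow_intertwine[OF _ _ _ eq, of y] x g by (simp add: int_pow_pow)
  have "g [^] k \<otimes> x [^] (1 + k * v) = x \<otimes> g [^] k"
  proof -
    have "g [^] k \<otimes> x [^] (1 + k * v)
        = g [^] (0::int) \<otimes> x [^] (1 + 0 * v) \<otimes> g [^] k"
    proof (rule int_pow_recurrence[where f = "\<lambda>k. g [^] k \<otimes> x [^] (1 + k * v)"])
      fix k :: int
      have "(1 + (k + 1) * v) - (1 + v) * (1 + k * v) = v * v * (- k)"
        by (simp add: algebra_simps)
      then have "x [^] (1 + (k + 1) * v) = x [^] ((1 + v) * (1 + k * v))"
        using N by (intro int_pow_cong[OF x]) simp
      then show "g [^] (k + 1) \<otimes> x [^] (1 + (k + 1) * v) = g [^] k \<otimes> x [^] (1 + k * v) \<otimes> g"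
        using x g int_pow_mult[of g k 1] step[of "1 + k * v"] by (simp add: m_assoc)
    qed (use x g in simp_all)
    then show ?thesis using x g by simp
  qed
  then have "x [^] n \<otimes> g [^] k = g [^] k \<otimes> (x [^] (1 + k * v)) [^] n"
    using x g by (intro int_pow_intertwine) simp_all
  then show ?thesis
    using x by (simp add: int_pow_pow mult.commute)
qed

text \<open>The situation in \<open>H\<close>, with \<open>w = 2^m \<ell>\<close> and \<open>N = 2^(2m-1)\<close>.  The factor 2 in \<open>2 N | w\<^sup>2\<close> is what makes
  \<open>w \<phi>(w y)\<close> vanish modulo \<open>N\<close> in spite of the denominator in \<open>\<phi>\<close>.\<close>

locale macdonald_quotient = macdonald G A B C "1 + w"
  for G (structure) and A B C :: 'a and w :: int +
  fixes N :: int
  assumes A_order: "A [^] N = \<one>" and B_order: "B [^] N = \<one>"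
    and w_even: "even w" and w_square: "2 * N dvd w * w"
begin

lemma pow_mem [simp]:
  "A [^] (n::int) \<in> carrier G" "B [^] (n::int) \<in> carrier G" "C [^] (n::int) \<in> carrier G"
  using ABC by simp_all

lemmas add_pow = int_pow_mult[OF A] int_pow_mult[OF B] int_pow_mult[OF C]

lemma ww: "N dvd w * w * x"
  using w_square by (metis dvd_mult2 dvd_mult_right)

lemma w_phi_w: "N dvd w * phi (w * y)"
proof -
  have e: "2 * (w * phi (w * y)) = w * w * (y * (w * y - 1))"
    unfolding mult.left_commute[of 2 w] two_phi by (simp add: algebra_simps)
  have "2 * N dvd 2 * (w * phi (w * y))"
    unfolding e using w_square by (rule dvd_mult2)
  then show ?thesis by simp
qed

lemma w_phi_cong: "N dvd w * phi (x + w * y) - w * phi x"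
proof -
  have "w * phi (x + w * y) - w * phi x = w * phi (w * y) + w * w * (x * y)"
    by (simp add: phi_add algebra_simps)
  then show ?thesis
    by (simp add: dvd_add w_phi_w ww)
qed

lemma ACpow: "A [^] (x::int) \<otimes> C [^] (k::int) = C [^] k \<otimes> A [^] (x * (1 + k * w))"
  using ww[of 1] by (intro int_pow_affine_conj[OF A A_order C AC]) simp

lemma BCpow: "B [^] (x::int) \<otimes> C [^] (k::int) = C [^] k \<otimes> B [^] (x * (1 - k * w))"
proof -
  have "B [^] x \<otimes> (inv C) [^] (- k) = (inv C) [^] (- k) \<otimes> B [^] (x * (1 + (- k) * w))"
    using ww[of 1] ABC BC' by (intro int_pow_affine_conj[OF B B_order _ BC']) simp_all
  then show ?thesis
    using C by (simp add: int_pow_inv int_pow_neg)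
qed

lemma CApow: "C [^] (k::int) \<otimes> A [^] (x::int) = A [^] (x * (1 - k * w)) \<otimes> C [^] k"
proof -
  have "x - x * (1 - k * w) * (1 + k * w) = w * w * (k * k * x)"
    by (simp add: algebra_simps)
  then have "A [^] x = A [^] (x * (1 - k * w) * (1 + k * w))"
    by (intro int_pow_cong[OF A A_order]) (simp only: ww)
  then show ?thesis by (simp add: ACpow)
qed

lemma CBpow: "C [^] (k::int) \<otimes> B [^] (x::int) = B [^] (x * (1 + k * w)) \<otimes> C [^] k"
proof -
  have "x - x * (1 + k * w) * (1 - k * w) = w * w * (k * k * x)"
    by (simp add: algebra_simps)
  then have "B [^] x = B [^] (x * (1 + k * w) * (1 - k * w))"
    by (intro int_pow_cong[OF B B_order]) (simp only: ww)
  then show ?thesis by (simp add: BCpow)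
qed

text \<open>This is \<open>A^n\<close> conjugated by \<open>B\<close>, since \<open>A^B = A C\<close>.  Collecting the \<open>C\<close>s to the right turns the
  \<open>t\<close>-th factor \<open>A\<close> into \<open>A^(1 - t w)\<close>, and the numbers \<open>t < n\<close> add up to \<open>\<phi>(n)\<close>.\<close>

lemma AC_pow: "(A \<otimes> C) [^] (n::int) = A [^] (n - w * phi n) \<otimes> C [^] n"
proof -
  define f where "f = (\<lambda>n. A [^] (n - w * phi n) \<otimes> C [^] n)"
  have "f n = f 0 \<otimes> (A \<otimes> C) [^] n"
  proof (rule int_pow_recurrence)
    fix n :: int
    have e: "(n + 1) - w * phi (n + 1) = (n - w * phi n) + (1 - n * w)"
      by (simp add: phi_add algebra_simps)
    have "f n \<otimes> (A \<otimes> C) = A [^] (n - w * phi n) \<otimes> (C [^] n \<otimes> A [^] (1::int)) \<otimes> C"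
      using ABC by (simp add: f_def m_assoc)
    also have "\<dots> = f (n + 1)"
      unfolding f_def CApow e add_pow(1,3) using ABC by (simp add: m_assoc)
    finally show "f (n + 1) = f n \<otimes> (A \<otimes> C)" ..
  qed (use ABC in \<open>simp_all add: f_def\<close>)
  then show ?thesis using ABC by (simp add: f_def)
qed

lemma B_invC_int_pow: "(B \<otimes> inv C) [^] (n::int) = B [^] (n - w * phi n) \<otimes> C [^] (- n)"
proof -
  define f where "f = (\<lambda>n. B [^] (n - w * phi n) \<otimes> C [^] (- n))"
  have "f n = f 0 \<otimes> (B \<otimes> inv C) [^] n"
  proof (rule int_pow_recurrence)
    fix n :: int
    have e: "(n + 1) - w * phi (n + 1) = (n - w * phi n) + 1 * (1 + (- n) * w)"
      by (simp add: phi_add algebra_simps)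
    have Cn: "C [^] (- (n + 1)) = C [^] (- n) \<otimes> inv C"
      using C int_pow_mult[of C "- n" "- 1"] int_pow_neg[of C 1] by simp
    have "f n \<otimes> (B \<otimes> inv C)
        = B [^] (n - w * phi n) \<otimes> (C [^] (- n) \<otimes> B [^] (1::int)) \<otimes> inv C"
      using ABC by (simp add: f_def m_assoc)
    also have "\<dots> = f (n + 1)"
      unfolding f_def CBpow e add_pow(2) Cn using ABC by (simp add: m_assoc)
    finally show "f (n + 1) = f n \<otimes> (B \<otimes> inv C)" ..
  qed (use ABC in \<open>simp_all add: f_def\<close>)
  then show ?thesis using ABC by (simp add: f_def)
qed

text \<open>Conjugating \<open>A^N = 1\<close> by \<open>B\<close> leaves \<open>1 = A^(N - w \<phi>(N)) C^N\<close>, where \<open>N\<close> divides \<open>w \<phi>(N)\<close>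
  because \<open>w\<close> is even.\<close>

lemma C_order: "C [^] N = \<one>"
proof -
  obtain v where v: "w = 2 * v" using w_even by blast
  have "w * phi N = v * (2 * phi N)" by (simp add: v)
  also have "\<dots> = N * (v * (N - 1))" unfolding two_phi by simp
  finally have "w * phi N = N * (v * (N - 1))" .
  then have AN: "A [^] (N - w * phi N) = A [^] (0::int)"
    by (intro int_pow_cong[OF A A_order]) (simp add: dvd_diff)
  have "A [^] N \<otimes> B = B \<otimes> (A [^] (N - w * phi N) \<otimes> C [^] N)"
    by (simp only: Apow_B AC_pow)
  then have "B \<otimes> C [^] N = B \<otimes> \<one>"
    using ABC by (simp only: A_order AN) simp
  then show ?thesis
    using ABC by (simp only: l_cancel pow_mem one_closed)
qed

lemmas A_cong = int_pow_cong[OF A A_order]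
lemmas B_cong = int_pow_cong[OF B B_order]
lemmas C_cong = int_pow_cong[OF C C_order]

lemma Cw_B: "C [^] (w * z) \<otimes> B [^] (x::int) = B [^] x \<otimes> C [^] (w * z)"
proof -
  have "B [^] (x * (1 + w * z * w)) = B [^] x"
    by (rule B_cong) (use ww[of "x * z"] in \<open>simp add: algebra_simps\<close>)
  then show ?thesis by (simp add: CBpow)
qed

text \<open>The powers \<open>A^(w z)\<close> commute with \<open>B\<close> up to the central elements \<open>C^(w z)\<close>: the correction
  \<open>w \<phi>(w z)\<close> from \<open>AC_pow\<close> vanishes modulo \<open>N\<close>.\<close>

lemma Aw_B: "A [^] (w * z) \<otimes> B [^] (y::int) = B [^] y \<otimes> (A [^] (w * z) \<otimes> C [^] (w * (z * y)))"
proof -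
  have "A [^] (w * z - w * phi (w * z)) = A [^] (w * z)"
    by (rule A_cong) (simp add: w_phi_w)
  then have 1: "A [^] (w * z) \<otimes> B = B \<otimes> (A [^] (w * z) \<otimes> C [^] (w * z))"
    by (simp add: Apow_B AC_pow)
  define f where "f = (\<lambda>y. B [^] y \<otimes> (A [^] (w * z) \<otimes> C [^] (w * (z * y))))"
  have "f y = f 0 \<otimes> B [^] y"
  proof (rule int_pow_recurrence)
    fix y :: int
    have "f y \<otimes> B = B [^] y \<otimes> (A [^] (w * z) \<otimes> (C [^] (w * (z * y)) \<otimes> B [^] (1::int)))"
      using ABC by (simp add: f_def m_assoc)
    also have "\<dots> = B [^] y \<otimes> ((A [^] (w * z) \<otimes> B) \<otimes> C [^] (w * (z * y)))"
      unfolding Cw_B using ABC by (simp add: m_assoc)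
    also have "\<dots> = B [^] y \<otimes> B \<otimes> (A [^] (w * z) \<otimes> (C [^] (w * z) \<otimes> C [^] (w * (z * y))))"
      unfolding 1 using ABC by (simp add: m_assoc)
    also have "C [^] (w * z) \<otimes> C [^] (w * (z * y)) = C [^] (w * (z * (y + 1)))"
      by (simp add: algebra_simps flip: add_pow)
    finally show "f (y + 1) = f y \<otimes> B"
      using ABC by (simp add: f_def int_pow_mult)
  qed (use ABC in \<open>simp_all add: f_def\<close>)
  then show ?thesis using ABC by (simp add: f_def)
qed

lemma B_Aw: "B [^] (y::int) \<otimes> A [^] (w * z) = A [^] (w * z) \<otimes> (B [^] y \<otimes> C [^] (- (w * (z * y))))"
proof -
  have "A [^] (w * z) \<otimes> (B [^] y \<otimes> C [^] (- (w * (z * y))))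
      = A [^] (w * z) \<otimes> B [^] y \<otimes> C [^] (- (w * (z * y)))"
    by (simp add: m_assoc)
  also have "\<dots> = B [^] y \<otimes> (A [^] (w * z) \<otimes> (C [^] (w * (z * y)) \<otimes> C [^] (- (w * (z * y)))))"
    by (simp add: Aw_B m_assoc)
  finally show ?thesis
    by (simp flip: add_pow)
qed

lemma phi_uminus: "phi (- j) = j * j - phi j"
  using phi_add[of j "- j"] by simp

text \<open>The collection rule for \<open>A\<close> and \<open>B\<close>, by recursion on \<open>a\<close>.  A further factor \<open>A\<close> first meets
  \<open>C^x\<close> with \<open>x \<equiv> - j a\<close> modulo \<open>w\<close>, which turns it into \<open>A A^(w j a)\<close>; then \<open>A\<close> passes \<open>B^y\<close> by
  \<open>B_invC_int_pow\<close>, and \<open>A^(w j a)\<close> passes it by \<open>B_Aw\<close>.\<close>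

lemma BApow:
  "B [^] (j::int) \<otimes> A [^] (a::int) = A [^] (a + w * phi a * j) \<otimes>
    (B [^] (j - w * a * phi j) \<otimes> C [^] (- (j * a) - w * phi a * phi (- j)))"
proof -
  define p where "p = (\<lambda>a. a + w * phi a * j)"
  define y where "y = (\<lambda>a. j - w * a * phi j)"
  define x where "x = (\<lambda>a. - (j * a) - w * phi a * phi (- j))"
  define f where "f = (\<lambda>a. A [^] p a \<otimes> (B [^] y a \<otimes> C [^] x a))"
  have "f a = f 0 \<otimes> A [^] a"
  proof (rule int_pow_recurrence)
    fix a :: int
    let ?z = "j * a"
    let ?y' = "y a - w * phi (y a)"
    have CxA: "C [^] x a \<otimes> A = A \<otimes> (A [^] (w * ?z) \<otimes> C [^] x a)"
    proof -
      have "1 * (1 - x a * w) - (1 + w * ?z) = w * w * (phi a * phi (- j))"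
        by (simp add: x_def algebra_simps)
      then have "A [^] (1 * (1 - x a * w)) = A [^] (1 + w * ?z)"
        by (intro A_cong) (simp only: ww)
      then show ?thesis
        using CApow[of "x a" 1] A by (simp add: add_pow m_assoc)
    qed
    have ByA: "B [^] y a \<otimes> A = A \<otimes> (B [^] ?y' \<otimes> C [^] (- y a))"
      by (simp add: Bpow_A B_invC_int_pow)
    have CyA: "C [^] (- y a) \<otimes> A [^] (w * ?z) = A [^] (w * ?z) \<otimes> C [^] (- y a)"
    proof -
      have "w * ?z * (1 - (- y a) * w) - w * ?z = w * w * (?z * y a)"
        by (simp add: algebra_simps)
      then have "A [^] (w * ?z * (1 - (- y a) * w)) = A [^] (w * ?z)"
        by (intro A_cong) (simp only: ww)
      then show ?thesis by (simp add: CApow)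
    qed
    have "f a \<otimes> A = A [^] p a \<otimes> (B [^] y a \<otimes> (C [^] x a \<otimes> A))"
      using A by (simp add: f_def m_assoc)
    also have "\<dots> = A [^] p a \<otimes> ((B [^] y a \<otimes> A) \<otimes> (A [^] (w * ?z) \<otimes> C [^] x a))"
      using A by (simp add: CxA m_assoc)
    also have "\<dots> = A [^] p a \<otimes> (A \<otimes> (B [^] ?y' \<otimes> ((C [^] (- y a) \<otimes> A [^] (w * ?z)) \<otimes> C [^] x a)))"
      using A by (simp add: ByA m_assoc)
    also have "\<dots> = A [^] p a \<otimes> (A \<otimes> ((B [^] ?y' \<otimes> A [^] (w * ?z)) \<otimes> (C [^] (- y a) \<otimes> C [^] x a)))"
      using A by (simp only: CyA) (simp add: m_assoc)
    also have "\<dots> = (A [^] p a \<otimes> A [^] (1::int) \<otimes> A [^] (w * ?z)) \<otimes>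
        (B [^] ?y' \<otimes> (C [^] (- (w * (?z * ?y'))) \<otimes> C [^] (- y a) \<otimes> C [^] x a))"
      using A by (simp only: B_Aw) (simp add: m_assoc)
    also have "A [^] p a \<otimes> A [^] (1::int) \<otimes> A [^] (w * ?z) = A [^] p (a + 1)"
      by (simp add: p_def phi_add algebra_simps flip: add_pow)
    also have "B [^] ?y' = B [^] y (a + 1)"
    proof (rule B_cong)
      have "?y' - y (a + 1) = - (w * phi (j + w * (- a * phi j)) - w * phi j)"
        by (simp add: y_def algebra_simps)
      then show "N dvd ?y' - y (a + 1)"
        using w_phi_cong[of j "- a * phi j"] by (simp only: dvd_minus_iff)
    qed
    also have "C [^] (- (w * (?z * ?y'))) \<otimes> C [^] (- y a) \<otimes> C [^] x a
        = C [^] (- (w * (?z * ?y')) + (- y a) + x a)"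
      by (simp flip: add_pow)
    also have "\<dots> = C [^] x (a + 1)"
    proof (rule C_cong)
      have "- (w * (?z * ?y')) + (- y a) + x a - x (a + 1)
          = w * w * (?z * (a * phi j + phi (y a)))"
        by (simp add: x_def phi_add phi_uminus y_def algebra_simps)
      then show "N dvd - (w * (?z * ?y')) + (- y a) + x a - x (a + 1)"
        by (simp only: ww)
    qed
    finally show "f (a + 1) = f a \<otimes> A"
      by (simp add: f_def)
  qed (use ABC in \<open>simp_all add: f_def\<close>)
  then have "f a = B [^] j \<otimes> A [^] a"
    by (simp add: f_def p_def x_def y_def)
  then show ?thesis
    by (simp add: f_def p_def x_def y_def)
qed

definition collected :: "int \<Rightarrow> int \<Rightarrow> int \<Rightarrow> 'a" where
  "collected i j k = A [^] i \<otimes> B [^] j \<otimes> C [^] k"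

lemma collected_closed [simp]: "collected i j k \<in> carrier G"
  by (simp add: collected_def)

lemma collected_cong:
  assumes "N dvd i - i'" "N dvd j - j'" "N dvd k - k'"
  shows "collected i j k = collected i' j' k'"
  unfolding collected_def A_cong[OF assms(1)] B_cong[OF assms(2)] C_cong[OF assms(3)] ..

text \<open>Moving \<open>C^k\<close> to the right scales \<open>a\<close> and \<open>b\<close> by \<open>1 \<mp> k w\<close>, then \<open>BApow\<close> exchanges the middle
  factors, and
  the power of \<open>C\<close> it creates passes \<open>B\<close>.  All terms with a factor \<open>w\<^sup>2\<close> disappear modulo \<open>N\<close>.\<close>

lemma collected_mult:
  "collected i j k \<otimes> collected a b c =
    collected (i + a + w * (j * phi a - k * a))
       (j + b + w * (k * b - a * phi j - j * a * b))
       (k + c - j * a + w * (j * k * a - phi a * phi (- j)))"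
proof -
  let ?a = "a * (1 - k * w)"
  let ?b = "b * (1 + k * w)"
  let ?x = "- (j * ?a) - w * phi ?a * phi (- j)"
  have "collected i j k \<otimes> collected a b c
      = A [^] i \<otimes> (B [^] j \<otimes> ((C [^] k \<otimes> A [^] a) \<otimes> (B [^] b \<otimes> C [^] c)))"
    by (simp add: collected_def m_assoc)
  also have "\<dots> = A [^] i \<otimes> ((B [^] j \<otimes> A [^] ?a) \<otimes> ((C [^] k \<otimes> B [^] b) \<otimes> C [^] c))"
    unfolding CApow by (simp add: m_assoc)
  also have "\<dots> = (A [^] i \<otimes> A [^] (?a + w * phi ?a * j)) \<otimes>
      (B [^] (j - w * ?a * phi j) \<otimes> ((C [^] ?x \<otimes> B [^] ?b) \<otimes> (C [^] k \<otimes> C [^] c)))"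
    unfolding CBpow[of k b] BApow by (simp add: m_assoc)
  also have "\<dots> = collected (i + (?a + w * phi ?a * j))
      ((j - w * ?a * phi j) + ?b * (1 + ?x * w)) (?x + (k + c))"
    unfolding CBpow collected_def add_pow by (simp add: m_assoc)
  also have "\<dots> = collected (i + a + w * (j * phi a - k * a))
       (j + b + w * (k * b - a * phi j - j * a * b))
       (k + c - j * a + w * (j * k * a - phi a * phi (- j)))"
  proof (rule collected_cong)
    have phi: "N dvd (w * phi ?a - w * phi a) * z" for z
    proof -
      have "?a = a + w * (- (a * k))" by (simp add: algebra_simps)
      then show ?thesis by (metis w_phi_cong dvd_mult2)
    qed
    have "i + (?a + w * phi ?a * j) - (i + a + w * (j * phi a - k * a))
        = (w * phi ?a - w * phi a) * j"
      by (simp add: algebra_simps)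
    then show "N dvd i + (?a + w * phi ?a * j) - (i + a + w * (j * phi a - k * a))"
      by (simp only: phi)
    have "?x + (k + c) - (k + c - j * a + w * (j * k * a - phi a * phi (- j)))
        = (w * phi ?a - w * phi a) * (- phi (- j))"
      by (simp add: algebra_simps)
    then show "N dvd ?x + (k + c) - (k + c - j * a + w * (j * k * a - phi a * phi (- j)))"
      by (simp only: phi)
    have "j - w * ?a * phi j + ?b * (1 + ?x * w) - (j + b + w * (k * b - a * phi j - j * a * b))
        = w * w * (a * k * phi j + b * (j * a * k - phi ?a * phi (- j) + k * ?x))"
      by (simp add: algebra_simps)
    then show "N dvd j - w * ?a * phi j + ?b * (1 + ?x * w)
        - (j + b + w * (k * b - a * phi j - j * a * b))"
      by (simp only: ww)
  qed
  finally show ?thesis .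
qed

text \<open>With \<open>(w p, w q, r)\<close> the claimed exponents, \<open>collected_mult\<close> expands both sides of \<open>x y = y x z\<close>.  Modulo
  \<open>N\<close> only terms of degree at most one in \<open>w\<close> survive; the single interaction
  between \<open>y x\<close> and \<open>z\<close> is the contribution
  \<open>- J w p\<close> to the exponent of \<open>C\<close>, from moving \<open>A^(w p)\<close> past the power \<open>B^J\<close> in \<open>y x\<close>.\<close>

lemma commutator_collected:
  "commutator G (collected i j k) (collected a b c) =
    collected (w * (j * phi a - phi i * b + i * c - k * a))
       (w * (i * phi b - phi j * a + k * b + j * (i * b - a * b - c)))
       (i * b - j * a
         + w * (phi a * (phi j + j * b) - phi i * (phi b + j * b) + i * j * c - k * a * b))"
proof -
  define p where "p = j * phi a - phi i * b + i * c - k * a"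
  define q where "q = i * phi b - phi j * a + k * b + j * (i * b - a * b - c)"
  define r where "r = i * b - j * a
    + w * (phi a * (phi j + j * b) - phi i * (phi b + j * b) + i * j * c - k * a * b)"
  \<comment> \<open>the exponents of \<open>y x\<close>\<close>
  define I where "I = a + i + w * (b * phi i - c * i)"
  define J where "J = b + j + w * (c * j - i * phi b - b * i * j)"
  define K where "K = c + k - b * i + w * (b * c * i - phi i * phi (- b))"
  define E where "E = phi (w * p)"
  have E: "N dvd w * E * z" for z
    unfolding E_def using w_phi_w by simp
  have "commutator G (collected i j k) (collected a b c) = collected (w * p) (w * q) r"
  proof (rule commutator_eqI)
    have "collected a b c \<otimes> collected i j k \<otimes> collected (w * p) (w * q) r
        = collected (I + w * p + w * (J * E - K * (w * p)))
             (J + w * q + w * (K * (w * q) - w * p * phi J - J * (w * p) * (w * q)))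
             (K + r - J * (w * p) + w * (J * K * (w * p) - E * phi (- J)))"
      unfolding collected_mult I_def J_def K_def E_def ..
    also have "\<dots> = collected (i + a + w * (j * phi a - k * a))
        (j + b + w * (k * b - a * phi j - j * a * b))
        (k + c - j * a + w * (j * k * a - phi a * phi (- j)))"
    proof (rule collected_cong)
      have "I + w * p + w * (J * E - K * (w * p)) - (i + a + w * (j * phi a - k * a))
          = w * E * J + w * w * (- (K * p))"
        by (simp add: I_def p_def algebra_simps)
      then show "N dvd I + w * p + w * (J * E - K * (w * p))
          - (i + a + w * (j * phi a - k * a))"
        by (simp only: dvd_add E ww)
      have "J + w * q + w * (K * (w * q) - w * p * phi J - J * (w * p) * (w * q))
          - (j + b + w * (k * b - a * phi j - j * a * b))
          = (J + w * q - (j + b + w * (k * b - a * phi j - j * a * b)))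
            + w * w * (K * q - p * phi J - J * p * (w * q))"
        by (simp add: algebra_simps)
      also have "J + w * q - (j + b + w * (k * b - a * phi j - j * a * b)) = 0"
        by (simp add: J_def q_def algebra_simps)
      finally show "N dvd J + w * q + w * (K * (w * q) - w * p * phi J - J * (w * p) * (w * q))
          - (j + b + w * (k * b - a * phi j - j * a * b))"
        by (simp only: add_0 ww)
      have "K + r - (b + j) * (w * p) - (k + c - j * a + w * (j * k * a - phi a * phi (- j))) = 0"
        unfolding phi_uminus K_def r_def p_def by (simp add: algebra_simps)
      moreover have Jp: "J * (w * p)
          = (b + j) * (w * p) + w * w * ((c * j - i * phi b - b * i * j) * p)"
        by (simp add: J_def algebra_simps)
      ultimately have "K + r - J * (w * p) + w * (J * K * (w * p) - E * phi (- J))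
          - (k + c - j * a + w * (j * k * a - phi a * phi (- j)))
          = w * E * (- phi (- J)) + w * w * (J * K * p - (c * j - i * phi b - b * i * j) * p)"
        using Jp by (simp add: algebra_simps)
      then show "N dvd K + r - J * (w * p) + w * (J * K * (w * p) - E * phi (- J))
          - (k + c - j * a + w * (j * k * a - phi a * phi (- j)))"
        by (simp only: dvd_add E ww)
    qed
    finally show "collected i j k \<otimes> collected a b c = collected a b c \<otimes> collected i j k \<otimes> collected (w * p) (w * q) r"
      unfolding collected_mult ..
  qed simp_all
  then show ?thesis
    unfolding p_def q_def r_def .
qed

end

section \<open>Quotients and presentations\<close>

lemma (in group_hom) hom_commutator:
  assumes "x \<in> carrier G" "y \<in> carrier G"
  shows "h (commutator G x y) = commutator H (h x) (h y)"
  unfolding commutator_def using assms by simp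

lemma (in group_hom) hom_conjugate:
  assumes "x \<in> carrier G" "y \<in> carrier G"
  shows "h (conjugate G x y) = conjugate H (h x) (h y)"
  unfolding conjugate_def using assms by simp

lemma (in group) commutator_closed [simp]:
  "x \<in> carrier G \<Longrightarrow> y \<in> carrier G \<Longrightarrow> commutator G x y \<in> carrier G"
  unfolding commutator_def by simp

lemma (in group) conjugate_closed [simp]:
  "x \<in> carrier G \<Longrightarrow> y \<in> carrier G \<Longrightarrow> conjugate G x y \<in> carrier G"
  unfolding conjugate_def by simp

lemma (in group) quotient_hom:
  assumes "N \<lhd> G"
  shows "group_hom G (G Mod N) (\<lambda>g. N #> g)"
proof -
  interpret N: normal N G by fact
  show ?thesis
    using N.r_coset_hom_Mod N.factorgroup_is_group is_group
    by (simp add: group_hom_def group_hom_axioms_def)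
qed

lemma (in group) quotient_kernel:
  assumes "N \<lhd> G" "x \<in> N"
  shows "N #> x = \<one>\<^bsub>G Mod N\<^esub>"
  using assms by (metis coset_join2 normal_imp_subgroup one_FactGroup subgroup.mem_carrier)

lemma (in group) normal_closure_superset:
  assumes "R \<subseteq> carrier G"
  shows "R \<subseteq> normal_closure G R"
proof
  fix r assume r: "r \<in> R"
  then have "r = \<one> \<otimes> r \<otimes> inv \<one>" using assms by auto
  then show "r \<in> normal_closure G R"
    unfolding normal_closure_def using r by (blast intro: generate.incl)
qed

text \<open>Presented groups are generated by the images of the free generators.  Here \<open>H\<close> will be the
  centralizer of an element.\<close>

lemma (in subgroup) generated_by_free_gens:
  assumes "group G" and hom: "h \<in> hom free_group G" and gens: "\<And>x. h (free_gen x) \<in> H"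
    and g: "g \<in> carrier free_group"
  shows "h g \<in> H"
proof -
  interpret h: group_hom free_group G h
    using assms group_free_group by (simp add: group_hom_def group_hom_axioms_def)
  have "h (free_rel `` {u}) \<in> H" for u
  proof (induction u)
    case Nil
    have "free_rel `` {[]} = \<one>\<^bsub>free_group\<^esub>" by (simp add: free_group_def)
    then show ?case using h.hom_one one_closed by metis
  next
    case (Cons y u)
    obtain x e where y: "y = (x, e)" by (cases y)
    have mem: "free_rel `` {v} \<in> carrier free_group" for v :: "'c word"
      by (auto simp: free_group_def intro: quotientI)
    have "free_rel `` {[(x, False)]} \<otimes>\<^bsub>free_group\<^esub> free_gen x = \<one>\<^bsub>free_group\<^esub>"
    proof -
      have "([(x, False), (x, True)], []) \<in> free_rel"
        using free_eq.cancel[of "[]" x False "[]"] by (simp add: free_rel_def)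
      then show ?thesis
        unfolding free_gen_def free_group_mult
        by (simp add: equiv_class_eq[OF equiv_free_rel] free_group_def)
    qed
    then have "free_rel `` {[(x, False)]} = inv\<^bsub>free_group\<^esub> free_gen x"
      using mem free_gen_carrier h.G.inv_equality by metis
    then have "h (free_rel `` {[(x, e)]}) \<in> H"
      using gens[of x] free_gen_carrier[of x]
      by (cases e) (simp_all add: free_gen_def[symmetric])
    moreover have "free_rel `` {y # u} = free_rel `` {[(x, e)]} \<otimes>\<^bsub>free_group\<^esub> free_rel `` {u}"
      by (simp add: free_group_mult y)
    ultimately show ?case
      using Cons.IH mem by simp
  qed
  then show ?thesis
    using g by (auto simp: free_group_def elim!: quotientE)
qed

lemma (in group) centralizer_subgroup:
  assumes z: "z \<in> carrier G"
  shows "subgroup {g \<in> carrier G. z \<otimes> g = g \<otimes> z} G"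
proof (rule subgroupI)
  fix a b assume "a \<in> {g \<in> carrier G. z \<otimes> g = g \<otimes> z}"
    and "b \<in> {g \<in> carrier G. z \<otimes> g = g \<otimes> z}"
  then have a: "a \<in> carrier G" "z \<otimes> a = a \<otimes> z" and b: "b \<in> carrier G" "z \<otimes> b = b \<otimes> z"
    by simp_all
  have "z \<otimes> (a \<otimes> b) = a \<otimes> z \<otimes> b"
    using m_assoc[OF z a(1) b(1)] a(2) by simp
  also have "\<dots> = a \<otimes> b \<otimes> z"
    using a b z by (simp add: m_assoc)
  finally show "a \<otimes> b \<in> {g \<in> carrier G. z \<otimes> g = g \<otimes> z}" using a b by simp
next
  fix a assume "a \<in> {g \<in> carrier G. z \<otimes> g = g \<otimes> z}"
  then have a: "a \<in> carrier G" "z \<otimes> a = a \<otimes> z" by simp_all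
  have "a \<otimes> (z \<otimes> inv a) = z \<otimes> a \<otimes> inv a"
    using m_assoc[OF a(1) z, of "inv a"] a by simp
  also have "\<dots> = z"
    using a(1) z by (simp add: m_assoc)
  finally have "inv a \<otimes> z = z \<otimes> inv a"
    using a(1) z by (simp add: inv_solve_left')
  then show "inv a \<in> {g \<in> carrier G. z \<otimes> g = g \<otimes> z}" using a by simp
qed (use z in auto)

section \<open>The groups \<open>J\<close> and \<open>H\<close>\<close>

abbreviation "J_kernel m l \<equiv> normal_closure free_group (J_relators m l)"

lemma J_kernel_normal: "J_kernel m l \<lhd> free_group"
  by (rule group.normal_closure_normal[OF group_free_group J_relators_carrier])

lemma J_hom: "group_hom free_group (J_group m l) (\<lambda>g. J_kernel m l #>\<^bsub>free_group\<^esub> g)"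
  unfolding J_group_def presented_group_def
  by (rule group.quotient_hom[OF group_free_group J_kernel_normal])

lemma J_relator:
  assumes "r \<in> J_relators m l"
  shows "J_kernel m l #>\<^bsub>free_group\<^esub> r = \<one>\<^bsub>J_group m l\<^esub>"
  unfolding J_group_def presented_group_def
  by (rule group.quotient_kernel[OF group_free_group J_kernel_normal])
    (use assms group.normal_closure_superset[OF group_free_group J_relators_carrier] in blast)

lemma center_J_groupI:
  assumes z: "z \<in> carrier (J_group m l)"
    and comm: "\<And>x. z \<otimes>\<^bsub>J_group m l\<^esub> presented_gen (J_relators m l) x
      = presented_gen (J_relators m l) x \<otimes>\<^bsub>J_group m l\<^esub> z"
  shows "z \<in> center (J_group m l)"
proof (rule centerI[OF z])
  interpret J: group "J_group m l" by (rule group_J_group)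
  let ?Z = "{g \<in> carrier (J_group m l). z \<otimes>\<^bsub>J_group m l\<^esub> g = g \<otimes>\<^bsub>J_group m l\<^esub> z}"
  interpret Z: subgroup ?Z "J_group m l" by (rule J.centralizer_subgroup[OF z])
  interpret h: group_hom free_group "J_group m l" "\<lambda>g. J_kernel m l #>\<^bsub>free_group\<^esub> g"
    by (rule J_hom)
  fix g assume "g \<in> carrier (J_group m l)"
  then obtain w where w: "w \<in> carrier free_group" "g = J_kernel m l #>\<^bsub>free_group\<^esub> w"
    by (auto simp: J_group_def presented_group_def carrier_FactGroup)
  have "presented_gen (J_relators m l) x \<in> ?Z" for x
    by (intro CollectI conjI presented_gen_carrier comm)
  then have "J_kernel m l #>\<^bsub>free_group\<^esub> free_gen x \<in> ?Z" for x
    unfolding presented_gen_def .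
  then have "g \<in> ?Z"
    unfolding w(2) by (rule Z.generated_by_free_gens[OF group_J_group h.homh _ w(1)])
  then show "z \<otimes>\<^bsub>J_group m l\<^esub> g = g \<otimes>\<^bsub>J_group m l\<^esub> z" by blast
qed

lemma J_relations:
  fixes m :: nat and l :: int
  defines "J \<equiv> J_group m l"
    and "A \<equiv> presented_gen (J_relators m l) GenA"
    and "B \<equiv> presented_gen (J_relators m l) GenB"
  shows "conjugate J A (commutator J A B) = A [^]\<^bsub>J\<^esub> alpha m l"
    and "conjugate J B (commutator J B A) = B [^]\<^bsub>J\<^esub> alpha m l"
    and "A [^]\<^bsub>J\<^esub> ((2::int) ^ (3 * m - 1)) = \<one>\<^bsub>J\<^esub>"
    and "B [^]\<^bsub>J\<^esub> ((2::int) ^ (3 * m - 1)) = \<one>\<^bsub>J\<^esub>"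
proof -
  let ?F = "free_group :: gen word set monoid"
  let ?h = "\<lambda>g. J_kernel m l #>\<^bsub>?F\<^esub> g"
  interpret h: group_hom ?F J ?h
    unfolding J_def by (rule J_hom)
  let ?a = "free_gen GenA" and ?b = "free_gen GenB"
  have A: "A = ?h ?a" and B: "B = ?h ?b"
    by (simp_all add: A_def B_def presented_gen_def)
  have rel: "?h r = \<one>\<^bsub>J\<^esub>" if "r \<in> J_relators m l" for r
    unfolding J_def using that by (rule J_relator)
  have eq: "?h u = ?h v"
    if "u \<otimes>\<^bsub>?F\<^esub> inv\<^bsub>?F\<^esub> v \<in> J_relators m l" "u \<in> carrier ?F" "v \<in> carrier ?F" for u v
    using rel[OF that(1)] that(2,3) by (simp add: h.H.inv_solve_right')
  have "?h (conjugate ?F ?a (commutator ?F ?a ?b)) = ?h (?a [^]\<^bsub>?F\<^esub> alpha m l)"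
    by (rule eq) (simp_all add: J_relators_def Let_def free_gen_carrier)
  then show "conjugate J A (commutator J A B) = A [^]\<^bsub>J\<^esub> alpha m l"
    by (simp add: A B h.hom_conjugate h.hom_commutator h.hom_int_pow free_gen_carrier)
  have "?h (conjugate ?F ?b (commutator ?F ?b ?a)) = ?h (?b [^]\<^bsub>?F\<^esub> alpha m l)"
    by (rule eq) (simp_all add: J_relators_def Let_def free_gen_carrier)
  then show "conjugate J B (commutator J B A) = B [^]\<^bsub>J\<^esub> alpha m l"
    by (simp add: A B h.hom_conjugate h.hom_commutator h.hom_int_pow free_gen_carrier)
  have pow: "x [^]\<^bsub>J\<^esub> ((2::int) ^ e) = x [^]\<^bsub>J\<^esub> ((2::nat) ^ e)" for x and e :: nat
    using int_pow_int[of J x "2 ^ e"] by simp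
  have "?h (?a [^]\<^bsub>?F\<^esub> ((2::nat) ^ (3 * m - 1))) = \<one>\<^bsub>J\<^esub>"
    "?h (?b [^]\<^bsub>?F\<^esub> ((2::nat) ^ (3 * m - 1))) = \<one>\<^bsub>J\<^esub>"
    by (rule rel, simp add: J_relators_def Let_def)+
  then show "A [^]\<^bsub>J\<^esub> ((2::int) ^ (3 * m - 1)) = \<one>\<^bsub>J\<^esub>"
    and "B [^]\<^bsub>J\<^esub> ((2::int) ^ (3 * m - 1)) = \<one>\<^bsub>J\<^esub>"
    by (simp_all add: A B pow h.hom_nat_pow free_gen_carrier)
qed

lemma (in group) macdonald_of_relations:
  assumes A: "A \<in> carrier G" and B: "B \<in> carrier G"
    and relA: "conjugate G A (commutator G A B) = A [^] q"
    and relB: "conjugate G B (commutator G B A) = B [^] q"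
  shows "macdonald G A B (commutator G A B) q"
proof (unfold_locales; (fact A B)?)
  let ?C = "commutator G A B"
  show C: "?C \<in> carrier G" using A B by simp
  show "A \<otimes> B = B \<otimes> A \<otimes> ?C"
    using A B by (rule commutator_swap)
  show "A \<otimes> ?C = ?C \<otimes> A [^] q"
    using relA A C by (simp add: conjugate_eq_iff)
  have "B \<otimes> inv ?C = inv ?C \<otimes> B [^] q"
    using relB A B by (simp add: conjugate_eq_iff inv_commutator)
  then have "?C \<otimes> (B \<otimes> inv ?C) \<otimes> ?C = ?C \<otimes> (inv ?C \<otimes> B [^] q) \<otimes> ?C"
    by simp
  then show "?C \<otimes> B = B [^] q \<otimes> ?C"
    using B C by (simp add: m_assoc mult_inv_cancel)
qed

text \<open>The exponent \<open>\<alpha>\<close> may be negative, whereas Macdonald's relation involves \<open>\<alpha>\<close> as a number of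
  factors.  As \<open>A\<close> and \<open>B\<close> have order dividing \<open>2^(3m-1)\<close>, the residue \<open>q\<close> of \<open>\<alpha>\<close> can take its place; it is
  still \<open>1\<close> plus \<open>2^m\<close> times an odd number.\<close>

lemma J_powers_central:
  fixes m :: nat and l :: int
  assumes "m > 0" "odd l"
  shows "presented_gen (J_relators m l) x [^]\<^bsub>J_group m l\<^esub> ((2::int) ^ (2 * m - 1))
    \<in> center (J_group m l)"
proof -
  define J where "J = J_group m l"
  define gen where "gen = presented_gen (J_relators m l)"
  interpret J: group J unfolding J_def by (rule group_J_group)
  let ?P = "(2::int) ^ (3 * m - 1)"
  note rels = J_relations[of m l, folded J_def gen_def]
  have gen: "gen x \<in> carrier J" for x
    unfolding J_def gen_def by (rule presented_gen_carrier)
  define q where "q = alpha m l mod ?P"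
  have pow_q: "gen x [^]\<^bsub>J\<^esub> alpha m l = gen x [^]\<^bsub>J\<^esub> q" for x
  proof (rule J.int_pow_cong[OF gen])
    show "gen x [^]\<^bsub>J\<^esub> ?P = \<one>\<^bsub>J\<^esub>" using rels(3,4) by (cases x) simp_all
    show "?P dvd alpha m l - q" by (simp add: q_def minus_mod_eq_mult_div)
  qed
  interpret macdonald J "gen GenA" "gen GenB" "commutator J (gen GenA) (gen GenB)" q
    using rels(1,2) unfolding pow_q by (intro J.macdonald_of_relations gen)
  have nonneg: "q = int (nat q)" by (simp add: q_def)
  obtain r where r: "q = 1 + 2 ^ m * r" "odd r"
  proof -
    define d where "d = alpha m l div ?P"
    have P: "?P = 2 ^ m * 2 ^ (2 * m - 1)"
      using assms(1) by (simp flip: power_add)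
    have "q = alpha m l - ?P * d"
      by (simp add: q_def d_def minus_mult_div_eq_mod)
    then have "q = 1 + 2 ^ m * (l - 2 ^ (2 * m - 1) * d)"
      unfolding P alpha_def by (simp add: algebra_simps)
    moreover have "odd (l - 2 ^ (2 * m - 1) * d)"
      using assms by simp
    ultimately show ?thesis by (rule that)
  qed
  let ?N = "(2::int) ^ (2 * m - 1)"
  note comm = power_commutes[OF nonneg r assms(1) rels(3,4)]
  have self: "gen x [^]\<^bsub>J\<^esub> ?N \<otimes>\<^bsub>J\<^esub> gen x = gen x \<otimes>\<^bsub>J\<^esub> gen x [^]\<^bsub>J\<^esub> ?N" for x
    by (rule J.int_pow_intertwine) (simp_all add: gen)
  have "gen x [^]\<^bsub>J\<^esub> ?N \<otimes>\<^bsub>J\<^esub> gen y = gen y \<otimes>\<^bsub>J\<^esub> gen x [^]\<^bsub>J\<^esub> ?N" for y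
    using comm self by (cases x; cases y) simp_all
  then have "gen x [^]\<^bsub>J\<^esub> ?N \<in> center J"
    by (intro center_J_groupI[of _ m l, folded J_def gen_def] J.int_pow_closed gen)
  then show ?thesis
    unfolding J_def gen_def .
qed

text \<open>The relations of \<open>J\<close> pass to \<open>H\<close>, where the central elements \<open>A^N\<close> and \<open>B^N\<close> die.\<close>

lemma H_macdonald_quotient:
  fixes m :: nat and l :: int
  assumes "m > 0" "odd l"
  shows "macdonald_quotient (H_group m l) (H_gen m l GenA) (H_gen m l GenB)
    (commutator (H_group m l) (H_gen m l GenA) (H_gen m l GenB)) (2 ^ m * l) (2 ^ (2 * m - 1))"
proof -
  let ?J = "J_group m l" and ?H = "H_group m l"
  let ?gen = "presented_gen (J_relators m l)"
  let ?N = "(2::int) ^ (2 * m - 1)"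
  let ?h = "\<lambda>g. center ?J #>\<^bsub>?J\<^esub> g"
  have Z: "center ?J \<lhd> ?J" by (rule group.center_normal[OF group_J_group])
  interpret h: group_hom ?J ?H ?h
    unfolding H_group_def by (rule group.quotient_hom[OF group_J_group Z])
  have gen: "H_gen m l x = ?h (?gen x)" for x
    by (simp add: H_gen_def)
  note mem = presented_gen_carrier[of m l]
  have "conjugate ?H (H_gen m l GenA) (commutator ?H (H_gen m l GenA) (H_gen m l GenB))
      = H_gen m l GenA [^]\<^bsub>?H\<^esub> alpha m l"
    using arg_cong[OF J_relations(1)[of m l], of ?h] mem
    by (simp add: gen h.hom_conjugate h.hom_commutator h.hom_int_pow)
  moreover have "conjugate ?H (H_gen m l GenB) (commutator ?H (H_gen m l GenB) (H_gen m l GenA))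
      = H_gen m l GenB [^]\<^bsub>?H\<^esub> alpha m l"
    using arg_cong[OF J_relations(2)[of m l], of ?h] mem
    by (simp add: gen h.hom_conjugate h.hom_commutator h.hom_int_pow)
  ultimately interpret macdonald ?H "H_gen m l GenA" "H_gen m l GenB"
      "commutator ?H (H_gen m l GenA) (H_gen m l GenB)" "1 + 2 ^ m * l"
    unfolding alpha_def by (intro h.H.macdonald_of_relations H_gen_carrier)
  show ?thesis
  proof unfold_locales
    have "H_gen m l x [^]\<^bsub>?H\<^esub> ?N = \<one>\<^bsub>?H\<^esub>" for x
    proof -
      have "H_gen m l x [^]\<^bsub>?H\<^esub> ?N = ?h (?gen x [^]\<^bsub>?J\<^esub> ?N)"
        using mem by (simp add: gen h.hom_int_pow)
      also have "\<dots> = \<one>\<^bsub>?H\<^esub>"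
        unfolding H_group_def
        by (rule group.quotient_kernel[OF group_J_group Z J_powers_central[OF assms]])
      finally show ?thesis .
    qed
    then show "H_gen m l GenA [^]\<^bsub>?H\<^esub> ?N = \<one>\<^bsub>?H\<^esub>" "H_gen m l GenB [^]\<^bsub>?H\<^esub> ?N = \<one>\<^bsub>?H\<^esub>"
      by blast+
    show "even (2 ^ m * l)" using assms(1) by simp
    have "Suc (2 * m - 1) = m + m" using assms(1) by simp
    then have "2 * ?N = 2 ^ m * 2 ^ m" by (simp flip: power_Suc power_add)
    then have "2 ^ m * l * (2 ^ m * l) = 2 * ?N * (l * l)" by simp
    then show "2 * ?N dvd 2 ^ m * l * (2 ^ m * l)" by (simp only: dvd_triv_left)
  qed
qed

theorem corollary6p3:
  fixes m :: nat and l i j k a b c :: int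
  assumes "m > 1" and "odd l"
  defines "H \<equiv> H_group m l"
    and "A \<equiv> H_gen m l GenA"
    and "B \<equiv> H_gen m l GenB"
    and "C \<equiv> commutator (H_group m l) (H_gen m l GenA) (H_gen m l GenB)"
    and "s \<equiv> (2::int) ^ (m - 1)"
  shows "commutator H
      (A [^]\<^bsub>H\<^esub> i \<otimes>\<^bsub>H\<^esub> B [^]\<^bsub>H\<^esub> j \<otimes>\<^bsub>H\<^esub> C [^]\<^bsub>H\<^esub> k)
      (A [^]\<^bsub>H\<^esub> a \<otimes>\<^bsub>H\<^esub> B [^]\<^bsub>H\<^esub> b \<otimes>\<^bsub>H\<^esub> C [^]\<^bsub>H\<^esub> c) =
    A [^]\<^bsub>H\<^esub> (2 * s * l * (j * phi a - phi i * b + i * c - k * a)) \<otimes>\<^bsub>H\<^esub>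
    B [^]\<^bsub>H\<^esub> (2 * s * l * (i * phi b - phi j * a + k * b + j * (i * b - a * b - c))) \<otimes>\<^bsub>H\<^esub>
    C [^]\<^bsub>H\<^esub> (i * b - j * a
      + 2 * s * l * (phi a * (phi j + j * b) - phi i * (phi b + j * b) + i * j * c - k * a * b))"
proof -
  interpret macdonald_quotient H A B C "2 ^ m * l" "2 ^ (2 * m - 1)"
    unfolding H_def A_def B_def C_def
    using assms(1,2) by (intro H_macdonald_quotient) simp_all
  have "2 * s = 2 ^ m"
    unfolding s_def using assms(1) by (simp flip: power_Suc)
  then show ?thesis
    using commutator_collected[of i j k a b c] unfolding collected_def by simp
qed

end
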